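(* Let $X$ be a real Hilbert space, $\psi:(0,\infty)\to(0,\infty)$, and let $A$ be a maximally monotone operator on $X$ which is inverse uniformly monotone with modulus $\psi$. Then $R_A$ is super strongly nonexpansive with modulus $\chi(\varepsilon):=4\psi(\varepsilon/2)$.
   Context: Let $X$ be a real Hilbert space. A set-valued operator $A\subseteq X\times X$ is monotone if $\langle a-c,b-d\rangle\ge0$ for all $(a,b),(c,d)\in A$; it is maximally monotone if it is maximal among monotone operators with respect to inclusion. $A$ is uniformly monotone with modulus $\psi:(0,\infty)\to(0,\infty)$ if for all $\varepsilon>0$ and all $(a,b),(c,d)\in A$ with $\|a-c\|\ge\varepsilon$, $\psi(\varepsilon)\le\langle a-c,b-d\rangle$; $A$ is inverse uniformly monotone with modulus $\psi$ if $A^{-1}=\{(b,a)\mid(a,b)\in A\}$ is uniformly monotone with modulus $\psi$. For $A$ maximally monotone, the resolvent $J_A:=(\mathrm{id}_X+A)^{-1}$ is a single-valued mapping $X\to X$, and the reflected resolvent is $R_A:=2J_A-\mathrm{id}_X:X\to X$. A mapping $T:X\to X$ is super strongly nonexpansive with modulus $\chi:(0,\infty)\to(0,\infty)$ if $\chi$ is an SSNE-modulus for $T$: for any $\varepsilon>0$ and $x,y\in X$ with $\|x-y\|^2-\|Tx-Ty\|^2<\chi(\varepsilon)$, we have $\|(x-y)-(Tx-Ty)\|<\varepsilon$. (Existence of such a $\chi$ is equivalent to $T$ being super strongly nonexpansive: $T$ is nonexpansive and, whenever $\|x_n-y_n\|^2-\|Tx_n-Ty_n\|^2\to0$, then $(x_n-y_n)-(Tx_n-Ty_n)\to0$.)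 *)

theory Defs
  imports "HOL-Analysis.Analysis"
begin

text \<open>
  Set-valued operators on \<open>X\<close> are relations \<open>A \<subseteq> X \<times> X\<close>; Hilbert spaces are types of sort
  \<open>{real_inner, complete_space}\<close>. A modulus \<open>(0,\<infinity>) \<rightarrow> (0,\<infinity>)\<close> is a function on the reals
  whose values at nonpositive arguments are irrelevant.
\<close>

definition pos_modulus :: "(real \<Rightarrow> real) \<Rightarrow> bool" where
  "pos_modulus \<psi> \<longleftrightarrow> (\<forall>\<epsilon>>0. \<psi> \<epsilon> > 0)"

definition monotone_operator :: "('a::real_inner \<times> 'a) set \<Rightarrow> bool" where
  "monotone_operator A \<longleftrightarrow> (\<forall>(a, b)\<in>A. \<forall>(c, d)\<in>A. (a - c) \<bullet> (b - d) \<ge> 0)"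

definition maximally_monotone :: "('a::real_inner \<times> 'a) set \<Rightarrow> bool" where
  "maximally_monotone A \<longleftrightarrow>
     monotone_operator A \<and> (\<forall>B. monotone_operator B \<and> A \<subseteq> B \<longrightarrow> B = A)"

definition uniformly_monotone :: "('a::real_inner \<times> 'a) set \<Rightarrow> (real \<Rightarrow> real) \<Rightarrow> bool" where
  "uniformly_monotone A \<psi> \<longleftrightarrow> pos_modulus \<psi> \<and>
     (\<forall>\<epsilon>>0. \<forall>(a, b)\<in>A. \<forall>(c, d)\<in>A. norm (a - c) \<ge> \<epsilon> \<longrightarrow> \<psi> \<epsilon> \<le> (a - c) \<bullet> (b - d))"

definition inverse_uniformly_monotone :: "('a::real_inner \<times> 'a) set \<Rightarrow> (real \<Rightarrow> real) \<Rightarrow> bool" where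
  "inverse_uniformly_monotone A \<psi> \<longleftrightarrow> uniformly_monotone (A\<inverse>) \<psi>"

definition id_plus :: "('a::real_vector \<times> 'a) set \<Rightarrow> ('a \<times> 'a) set" where
  "id_plus A = {(a, a + b) | a b. (a, b) \<in> A}"

text \<open>
  The relation \<open>(id + A)\<inverse>\<close> is single-valued and total when \<open>A\<close> is maximally monotone
  on a Hilbert space (Minty); otherwise the description below may be unspecified.
\<close>

definition resolvent :: "('a::real_inner \<times> 'a) set \<Rightarrow> 'a \<Rightarrow> 'a" where
  "resolvent A x = (THE p. (x, p) \<in> (id_plus A)\<inverse>)"

definition reflected_resolvent :: "('a::real_inner \<times> 'a) set \<Rightarrow> 'a \<Rightarrow> 'a" where
  "reflected_resolvent A x = 2 *\<^sub>R resolvent A x - x"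

text \<open>
  Nonexpansiveness is implied: if \<open>norm (T x - T y) > norm (x - y)\<close>, the premise below holds
  for every \<open>\<epsilon>\<close>, which forces \<open>x - y = T x - T y\<close>.
\<close>

definition super_strongly_nonexpansive :: "('a::real_inner \<Rightarrow> 'a) \<Rightarrow> (real \<Rightarrow> real) \<Rightarrow> bool" where
  "super_strongly_nonexpansive T \<phi> \<longleftrightarrow> pos_modulus \<phi> \<and>
     (\<forall>\<epsilon>>0. \<forall>x y. (norm (x - y))\<^sup>2 - (norm (T x - T y))\<^sup>2 < \<phi> \<epsilon>
        \<longrightarrow> norm ((x - y) - (T x - T y)) < \<epsilon>)"

end

theory Submission
  imports Defs
begin

text \<open>
  Solvability of \<open>0 \<in> p + A p\<close> (Minty) is obtained following Simons and Zalinescu. The Fitzpatrick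
  function \<open>F (p, q) = sup {p \<bullet> b + a \<bullet> q - a \<bullet> b | (a, b) \<in> A}\<close> is convex, lower semicontinuous,
  bounded below by \<open>p \<bullet> q\<close> and equal to it on \<open>A\<close>. Hence
  \<open>F (p, q) + (norm (p, q))\<^sup>2 / 2\<close> is nonnegative and strongly convex, so it has a minimizer
  \<open>(p, q)\<close>; its optimality condition says that \<open>(-q, -p)\<close> is monotonically related to \<open>A\<close> and,
  once \<open>(-q, -p) \<in> A\<close> is known, that \<open>p = -q\<close>. The modulus is then read off from the identity
  \<open>(norm (x - y))\<^sup>2 - (norm (R x - R y))\<^sup>2 = 4 * ((J x - J y) \<bullet> ((x - J x) - (y - J y)))\<close>.
\<close>

text \<open>The set \<open>E\<close> plays the role of the epigraph of an extended-real-valued convex function \<open>f\<close>;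
  the conclusion says that \<open>-x\<close> is a subgradient of \<open>f\<close> at \<open>x\<close>.\<close>

lemma convex_plus_half_norm_sq_minimizer:
  fixes E :: "('h::{real_inner, complete_space} \<times> real) set"
  assumes "convex E" "closed E" "E \<noteq> {}"
    and lb: "\<And>x t. (x, t) \<in> E \<Longrightarrow> c \<le> t + (norm x)\<^sup>2 / 2"
  obtains x t where "(x, t) \<in> E" "\<And>y s. (y, s) \<in> E \<Longrightarrow> t \<le> s + x \<bullet> (y - x)"
proof -
  define v where "v z = snd z + (norm (fst z))\<^sup>2 / 2" for z :: "'h \<times> real"
  define m where "m = Inf (v ` E)"
  have bdd: "bdd_below (v ` E)"
    by (rule bdd_belowI[of _ c]) (auto simp: v_def lb)
  have mle: "m \<le> v z" if "z \<in> E" for z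
    unfolding m_def using bdd that by (simp add: cINF_lower)
  have "\<exists>z\<in>E. v z < m + 1 / real (Suc n)" for n
  proof -
    have "Inf (v ` E) < m + 1 / real (Suc n)" by (simp add: m_def)
    then show ?thesis using cInf_less_iff[of "v ` E"] bdd \<open>E \<noteq> {}\<close> by auto
  qed
  then obtain Z where ZE: "\<And>n. Z n \<in> E" and Zv: "\<And>n. v (Z n) < m + 1 / real (Suc n)"
    by metis
  \<comment> \<open>By the parallelogram law \<open>v\<close> at the midpoint lies
    \<open>(norm (fst z - fst w))\<^sup>2 / 8\<close> below the average of \<open>v z\<close> and
    \<open>v w\<close>, yet it is at least \<open>m\<close>.\<close>
  have mid: "(norm (fst z - fst w))\<^sup>2 \<le> 4 * (v z - m) + 4 * (v w - m)" if "z \<in> E" "w \<in> E" for z w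
  proof -
    have "(1/2) *\<^sub>R z + (1/2) *\<^sub>R w \<in> E"
      using \<open>convex E\<close> that unfolding convex_def by auto
    from mle[OF this] show ?thesis
      by (simp add: v_def power2_norm_eq_inner inner_simps inner_commute field_simps)
  qed
  have "Cauchy (\<lambda>n. fst (Z n))"
  proof (rule metric_CauchyI)
    fix e :: real assume "e > 0"
    \<comment> \<open>With both gaps below \<open>e\<^sup>2 / 8\<close>, the bound
      \<open>mid\<close> adds up to less than \<open>e\<^sup>2\<close>.\<close>
    then obtain N :: nat where N: "8 / e\<^sup>2 < real N" using reals_Archimedean2 by blast
    have "8 / e\<^sup>2 > 0" using \<open>e > 0\<close> by simp
    with N have "real N > 0" by linarith
    with N \<open>e > 0\<close> have N': "1 / real N < e\<^sup>2 / 8" by (simp add: field_simps)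
    have est: "v (Z j) - m < e\<^sup>2 / 8" if "j \<ge> N" for j
    proof -
      have "1 / real (Suc j) \<le> 1 / real N" using that \<open>real N > 0\<close> by (simp add: frac_le)
      with Zv[of j] N' show ?thesis by linarith
    qed
    have "dist (fst (Z j)) (fst (Z k)) < e" if "j \<ge> N" "k \<ge> N" for j k
    proof -
      have "(norm (fst (Z j) - fst (Z k)))\<^sup>2 < e\<^sup>2"
        using mid[OF ZE ZE, of j k] est[OF that(1)] est[OF that(2)] by argo
      then show ?thesis using \<open>e > 0\<close> by (simp add: dist_norm power_less_imp_less_base)
    qed
    then show "\<exists>M. \<forall>j\<ge>M. \<forall>k\<ge>M. dist (fst (Z j)) (fst (Z k)) < e" by blast
  qed
  then obtain x where x: "(\<lambda>n. fst (Z n)) \<longlonglongrightarrow> x"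
    using Cauchy_convergent convergent_def by blast
  have vlim: "(\<lambda>n. v (Z n)) \<longlonglongrightarrow> m"
  proof (rule tendsto_sandwich[OF _ _ tendsto_const])
    show "(\<lambda>n. m + 1 / real (Suc n)) \<longlonglongrightarrow> m"
      using tendsto_add[OF tendsto_const LIMSEQ_Suc[OF lim_1_over_n], of m] by simp
    show "\<forall>\<^sub>F n in sequentially. v (Z n) \<le> m + 1 / real (Suc n)"
      using Zv less_imp_le by (intro always_eventually) blast
    show "\<forall>\<^sub>F n in sequentially. m \<le> v (Z n)"
      using mle ZE by simp
  qed
  \<comment> \<open>Strong convexity controls only the first components; the limit of the second
    ones is forced by \<open>v (Z n)\<close> tending to \<open>m\<close>.\<close>
  define t where "t = m - (norm x)\<^sup>2 / 2"
  have "(\<lambda>n. v (Z n) - (norm (fst (Z n)))\<^sup>2 / 2) \<longlonglongrightarrow> t"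
    unfolding t_def by (intro tendsto_intros vlim x) simp
  then have "(\<lambda>n. snd (Z n)) \<longlonglongrightarrow> t"
    by (simp add: v_def)
  with x have "(\<lambda>n. (fst (Z n), snd (Z n))) \<longlonglongrightarrow> (x, t)"
    by (rule tendsto_Pair)
  then have xt: "(x, t) \<in> E"
    using \<open>closed E\<close> ZE by (simp add: closed_sequential_limits) blast
  have "t \<le> s + x \<bullet> (y - x)" if ys: "(y, s) \<in> E" for y s
  proof -
    \<comment> \<open>Minimality is tested at the point a fraction \<open>l\<close> of the way from
      \<open>(x, t)\<close> to \<open>(y, s)\<close>; after division by \<open>l\<close>, the
      quadratic remainder vanishes as \<open>l\<close> tends to 0.\<close>
    have "t \<le> s + x \<bullet> (y - x) + l * ((norm (y - x))\<^sup>2 / 2)" if l: "0 < l" "l \<le> 1" for l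
    proof -
      have "(1 - l) *\<^sub>R (x, t) + l *\<^sub>R (y, s) \<in> E"
        using convexD_alt[OF \<open>convex E\<close> xt ys, of l] l by simp
      from mle[OF this]
      have "l * t \<le> l * (s + x \<bullet> (y - x) + l * ((norm (y - x))\<^sup>2 / 2))"
        by (simp add: v_def t_def power2_norm_eq_inner inner_simps inner_commute field_simps)
      with l show ?thesis by simp
    qed
    then have ev: "\<forall>\<^sub>F l in at_right 0. t \<le> s + x \<bullet> (y - x) + l * ((norm (y - x))\<^sup>2 / 2)"
      by (auto simp: eventually_at_right_less intro!: eventually_at_rightI[of 0 1])
    have lim: "((\<lambda>l. s + x \<bullet> (y - x) + l * ((norm (y - x))\<^sup>2 / 2)) \<longlongrightarrow>
       s + x \<bullet> (y - x) + 0 * ((norm (y - x))\<^sup>2 / 2)) (at_right 0)"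
      by (intro tendsto_intros)
    show ?thesis
      using tendsto_lowerbound[OF lim ev] by simp
  qed
  with xt show ?thesis using that by blast
qed

lemma maximally_monotone_memI:
  assumes "maximally_monotone A"
    and "\<And>a b. (a, b) \<in> A \<Longrightarrow> 0 \<le> (p - a) \<bullet> (q - b)"
  shows "(p, q) \<in> A"
proof -
  have *: "(a - p) \<bullet> (b - q) = (p - a) \<bullet> (q - b)" for a b
    by (simp add: inner_simps)
  have "monotone_operator (insert (p, q) A)"
    using assms unfolding maximally_monotone_def monotone_operator_def by (auto simp: *)
  with assms(1) show ?thesis
    unfolding maximally_monotone_def by blast
qed

text \<open>Translating the values by \<open>z\<close> reduces the inclusion
  \<open>z \<in> p + A p\<close> to the case of right-hand side 0.\<close>

lemma maximally_monotone_shift: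
  assumes A: "maximally_monotone A"
  shows "maximally_monotone {(a, b). (a, b + z) \<in> A}"
proof -
  have mono: "0 \<le> (a - c) \<bullet> (b - d)" if "(a, b) \<in> A" "(c, d) \<in> A" for a b c d
    using A that unfolding maximally_monotone_def monotone_operator_def by blast
  have "B = {(a, b). (a, b + z) \<in> A}"
    if B: "monotone_operator B" "{(a, b). (a, b + z) \<in> A} \<subseteq> B" for B
  proof -
    have "(p, q + z) \<in> A" if "(p, q) \<in> B" for p q
    proof (rule maximally_monotone_memI[OF A])
      fix a b assume "(a, b) \<in> A"
      then have "(a, b - z) \<in> B" using B(2) by auto
      with B(1) that have "0 \<le> (p - a) \<bullet> (q - (b - z))"
        unfolding monotone_operator_def by blast
      then show "0 \<le> (p - a) \<bullet> (q + z - b)" by (simp add: algebra_simps)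
    qed
    with B(2) show ?thesis by auto
  qed
  moreover have "monotone_operator {(a, b). (a, b + z) \<in> A}"
    unfolding monotone_operator_def using mono[of _ "_ + z" _ "_ + z"] by auto
  ultimately show ?thesis
    unfolding maximally_monotone_def by blast
qed

lemma maximally_monotone_zero:
  fixes A :: "('a::{real_inner, complete_space} \<times> 'a) set"
  assumes A: "maximally_monotone A"
  obtains p where "(p, -p) \<in> A"
proof -
  have mono: "0 \<le> (a - c) \<bullet> (b - d)" if "(a, b) \<in> A" "(c, d) \<in> A" for a b c d
    using A that unfolding maximally_monotone_def monotone_operator_def by blast
  \<comment> \<open>The epigraph of the Fitzpatrick function, written as an intersection of closed
    half-spaces, so that convexity and closedness are immediate and no infinite values
    occur.\<close>
  define E where "E = (\<Inter>(a, b)\<in>A. {w. (b, a) \<bullet> fst w - a \<bullet> b \<le> snd w})"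
  have mem_E: "((p, q), t) \<in> E \<longleftrightarrow> (\<forall>(a, b)\<in>A. b \<bullet> p + a \<bullet> q - a \<bullet> b \<le> t)" for p q t
    by (auto simp: E_def)
  have graph: "((a, b), a \<bullet> b) \<in> E" if "(a, b) \<in> A" for a b
    using mono[OF that] by (fastforce simp: mem_E inner_simps inner_commute)
  have ge: "p \<bullet> q \<le> t" if E: "((p, q), t) \<in> E" for p q t
  proof (rule ccontr)
    \<comment> \<open>Membership in \<open>E\<close> gives
      \<open>p \<bullet> q - t \<le> (p - a) \<bullet> (q - b)\<close> on \<open>A\<close>, so
      maximality puts \<open>(p, q)\<close> into \<open>A\<close>; the half-space of this very pair
      then says \<open>p \<bullet> q \<le> t\<close>.\<close>
    assume "\<not> p \<bullet> q \<le> t"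
    with E have "0 \<le> (p - a) \<bullet> (q - b)" if "(a, b) \<in> A" for a b
      using that by (fastforce simp: mem_E inner_simps inner_commute)
    then have "(p, q) \<in> A" by (rule maximally_monotone_memI[OF A])
    with E \<open>\<not> p \<bullet> q \<le> t\<close> show False by (fastforce simp: mem_E inner_commute)
  qed
  have "convex E"
    unfolding E_def
  proof (intro convex_INT, clarify)
    fix a b :: 'a
    have eq: "{w. (b, a) \<bullet> fst w - a \<bullet> b \<le> snd w} = {w. ((b, a), -1) \<bullet> w \<le> a \<bullet> b}"
      by (auto simp: inner_prod_def)
    show "convex {w. (b, a) \<bullet> fst w - a \<bullet> b \<le> snd w}"
      unfolding eq by (rule convex_halfspace_le)
  qed
  moreover have "closed E"
    unfolding E_def by (auto intro!: closed_INT closed_Collect_le continuous_intros)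
  \<comment> \<open>\<open>A\<close> is nonempty: otherwise \<open>(0, 0)\<close> would be vacuously
    related to it and belong to it by maximality.\<close>
  moreover have "E \<noteq> {}"
    using graph maximally_monotone_memI[OF A, of 0 0] by blast
  moreover have "0 \<le> t + (norm x)\<^sup>2 / 2" if "(x, t) \<in> E" for x t
  proof -
    obtain p q where x: "x = (p, q)" by (cases x)
    have "0 \<le> (norm (p + q))\<^sup>2" by simp
    with ge[of p q t] that show ?thesis
      by (simp add: x power2_norm_eq_inner inner_simps inner_commute field_simps)
  qed
  ultimately obtain p q t where E: "((p, q), t) \<in> E"
    and opt: "\<And>y s. (y, s) \<in> E \<Longrightarrow> t \<le> s + (p, q) \<bullet> (y - (p, q))"
    by (metis convex_plus_half_norm_sq_minimizer surj_pair)
  \<comment> \<open>Optimality against the epigraph point \<open>((a, b), a \<bullet> b)\<close>,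
    combined with \<open>p \<bullet> q \<le> t\<close>, after completing the square.\<close>
  have key: "(norm (p + q))\<^sup>2 \<le> (a + q) \<bullet> (b + p)" if "(a, b) \<in> A" for a b
    using opt[OF graph[OF that]] ge[OF E]
    by (simp add: power2_norm_eq_inner inner_simps inner_commute)
  have "(- q, - p) \<in> A"
  proof (rule maximally_monotone_memI[OF A])
    fix a b assume "(a, b) \<in> A"
    then have "0 \<le> (a + q) \<bullet> (b + p)" using key order_trans[OF zero_le_power2] by blast
    then show "0 \<le> (- q - a) \<bullet> (- p - b)" by (simp add: inner_simps inner_commute)
  qed
  \<comment> \<open>At \<open>(a, b) = (- q, - p)\<close> the right-hand side of \<open>key\<close>
    is 0.\<close>
  moreover from key[OF this] have "p = - q"
    by (simp add: eq_neg_iff_add_eq_0)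
  ultimately show ?thesis using that[of "- q"] by simp
qed

lemma minty:
  fixes A :: "('a::{real_inner, complete_space} \<times> 'a) set"
  assumes "maximally_monotone A"
  obtains p where "(p, z - p) \<in> A"
  using maximally_monotone_zero[OF maximally_monotone_shift[OF assms, of z]]
  by (auto simp: algebra_simps)

text \<open>This makes the definite description meaningful: \<open>minty\<close> supplies a
  candidate, and monotonicity applied to two candidates gives
  \<open>0 \<le> - ((norm (r - p))\<^sup>2)\<close>.\<close>

lemma resolvent_mem:
  fixes A :: "('a::{real_inner, complete_space} \<times> 'a) set"
  assumes A: "maximally_monotone A"
  shows "(resolvent A x, x - resolvent A x) \<in> A"
proof -
  have rel: "(x, p) \<in> (id_plus A)\<inverse> \<longleftrightarrow> (p, x - p) \<in> A" for p
    by (force simp: id_plus_def)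
  obtain p where p: "(p, x - p) \<in> A" using minty[OF A] .
  have "r = p" if "(r, x - r) \<in> A" for r
  proof -
    have "0 \<le> (r - p) \<bullet> ((x - r) - (x - p))"
      using A that p unfolding maximally_monotone_def monotone_operator_def by blast
    also have "\<dots> = - ((norm (r - p))\<^sup>2)"
      by (simp add: power2_norm_eq_inner inner_simps inner_commute)
    finally show ?thesis by simp
  qed
  with p have "resolvent A x = p"
    unfolding resolvent_def rel by (rule the_equality)
  with p show ?thesis by simp
qed

theorem proposition3p7:
  fixes A :: "('a::{real_inner, complete_space} \<times> 'a) set"
    and \<psi> :: "real \<Rightarrow> real"
  assumes "pos_modulus \<psi>"
    and "maximally_monotone A"
    and "inverse_uniformly_monotone A \<psi>"
  shows "super_strongly_nonexpansive (reflected_resolvent A) (\<lambda>\<epsilon>. 4 * \<psi> (\<epsilon> / 2))"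
  unfolding super_strongly_nonexpansive_def
proof (intro conjI allI impI)
  show "pos_modulus (\<lambda>\<epsilon>. 4 * \<psi> (\<epsilon> / 2))"
    using assms(1) by (simp add: pos_modulus_def)
next
  fix \<epsilon> :: real and x y :: 'a
  let ?R = "reflected_resolvent A"
  define p where "p = resolvent A x"
  define q where "q = resolvent A y"
  assume "0 < \<epsilon>"
    and less: "(norm (x - y))\<^sup>2 - (norm (?R x - ?R y))\<^sup>2 < 4 * \<psi> (\<epsilon> / 2)"
  have "(norm (x - y))\<^sup>2 - (norm (?R x - ?R y))\<^sup>2 = 4 * (((x - p) - (y - q)) \<bullet> (p - q))"
    by (simp add: reflected_resolvent_def p_def q_def power2_norm_eq_inner inner_simps
        inner_commute algebra_simps)
  with less have "((x - p) - (y - q)) \<bullet> (p - q) < \<psi> (\<epsilon> / 2)" by simp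
  moreover have "(x - p, p) \<in> A\<inverse>" "(y - q, q) \<in> A\<inverse>"
    using resolvent_mem[OF assms(2)] by (simp_all add: p_def q_def)
  then have "\<epsilon> / 2 \<le> norm ((x - p) - (y - q)) \<longrightarrow> \<psi> (\<epsilon> / 2) \<le> ((x - p) - (y - q)) \<bullet> (p - q)"
    using assms(3) half_gt_zero[OF \<open>0 < \<epsilon>\<close>]
    unfolding inverse_uniformly_monotone_def uniformly_monotone_def by blast
  ultimately have "norm ((x - p) - (y - q)) < \<epsilon> / 2" by fastforce
  \<comment> \<open>This factor 2 is why the modulus is evaluated at \<open>\<epsilon> / 2\<close>;
    the factor 4 comes from the difference of squares.\<close>
  moreover have "(x - y) - (?R x - ?R y) = 2 *\<^sub>R ((x - p) - (y - q))"
    by (simp add: reflected_resolvent_def p_def q_def algebra_simps scaleR_2)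
  ultimately show "norm ((x - y) - (?R x - ?R y)) < \<epsilon>"
    by simp
qed

end
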